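(* Let $A$ be an $m\times m$ nonsingular real matrix, let $z\in\mathbb{R}^m$, and let $K=A\mathbb{R}^m_+$. Let $b\in(0,1/3)$. If $$\|A^\top A-I\|<b,$$ then, for any starting point $x_0\in\mathbb{R}^m$, the semi-smooth Newton sequence $\{x_k\}$, determined by $$\left(\left(A^\top A-I\right)\operatorname{diag}(\operatorname{sgn}(x_k^+))+I\right)x_{k+1}=A^\top z,\qquad k=0,1,2,\ldots,$$ converges linearly to the unique solution $u$ of the equation $$\left(A^\top A-I\right)x^++x=A^\top z,$$ and $P_K(z)=Au^+$.
   Context: $\mathbb{R}^m$ carries the canonical scalar product and the Euclidean norm $\|\cdot\|$; for an $m\times m$ matrix $M$, $\|M\|=\max\{\|Mx\|:\|x\|=1\}$. $I$ is the $m\times m$ identity matrix. For $x=(x^1,\dots,x^m)\in\mathbb{R}^m$, $x^+=(\max\{x^1,0\},\dots,\max\{x^m,0\})$; $\operatorname{sgn}(x)$ is the vector whose components are $1$, $0$ or $-1$ according to whether the corresponding component of $x$ is positive, zero or negative; $\operatorname{diag}(x)$ is the diagonal matrix with diagonal entries the components of $x$. So $\operatorname{diag}(\operatorname{sgn}(x^+))$ is diagonal with entries $1$ where $x^i>0$ and $0$ elsewhere. $\mathbb{R}^m_+$ is the nonnegative orthant, $K=A\mathbb{R}^m_+=\{Ay:y\in\mathbb{R}^m_+\}$ is the simplicial cone associated with $A$, and $P_K(z)=\operatorname{argmin}\{\|z-y\|:y\in K\}$ is the metric projection of $z$ onto $K$. A sequence $\{x_k\}$ converges linearly to $u$ if $x_k\to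 u$ and there is $c\in[0,1)$ such that $\|x_{k+1}-u\|\le c\|x_k-u\|$ for all sufficiently large $k$. *)

theory Defs
  imports "HOL-Analysis.Analysis"
begin

definition pos_part :: "real ^ 'm \<Rightarrow> real ^ 'm"
  where "pos_part x = (\<chi> i. max (x $ i) 0)"

text \<open>The componentwise sign; the constant \<open>sgn\<close> at type \<open>real ^ 'm\<close> is the normalisation
  \<open>x /\<^sub>R norm x\<close> instead.\<close>

definition sign_vec :: "real ^ 'm \<Rightarrow> real ^ 'm"
  where "sign_vec x = (\<chi> i. sgn (x $ i))"

definition diag_mat :: "real ^ 'm \<Rightarrow> real ^ 'm ^ 'm"
  where "diag_mat x = (\<chi> i j. if i = j then x $ i else 0)"

definition nonneg_orthant :: "(real ^ 'm) set"
  where "nonneg_orthant = {y. \<forall>i. 0 \<le> y $ i}"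

definition simplicial_cone :: "real ^ 'm ^ 'm \<Rightarrow> (real ^ 'm) set"
  where "simplicial_cone A = (\<lambda>y. A *v y) ` nonneg_orthant"

definition op_norm :: "real ^ 'm ^ 'm \<Rightarrow> real"
  where "op_norm M = onorm ((*v) M)"

definition solves_pw_linear :: "real ^ 'm ^ 'm \<Rightarrow> real ^ 'm \<Rightarrow> real ^ 'm \<Rightarrow> bool"
  where "solves_pw_linear A z x \<longleftrightarrow>
    (transpose A ** A - mat 1) *v pos_part x + x = transpose A *v z"

definition semismooth_newton_seq ::
    "real ^ 'm ^ 'm \<Rightarrow> real ^ 'm \<Rightarrow> real ^ 'm \<Rightarrow> (nat \<Rightarrow> real ^ 'm) \<Rightarrow> bool"
  where "semismooth_newton_seq A z x0 x \<longleftrightarrow> x 0 = x0 \<and>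
    (\<forall>k. ((transpose A ** A - mat 1) ** diag_mat (sign_vec (pos_part (x k))) + mat 1) *v x (Suc k)
          = transpose A *v z)"

definition converges_linearly :: "(nat \<Rightarrow> 'a::real_normed_vector) \<Rightarrow> 'a \<Rightarrow> bool"
  where "converges_linearly x u \<longleftrightarrow> x \<longlonglongrightarrow> u \<and>
    (\<exists>c. 0 \<le> c \<and> c < 1 \<and>
      (\<forall>\<^sub>F k in sequentially. norm (x (Suc k) - u) \<le> c * norm (x k - u)))"

end

theory Submission
  imports Defs
begin

text \<open>Write \<open>E = A\<^sup>T A - I\<close>. The solution \<open>u\<close> is the fixed point of the contraction
  \<open>x \<mapsto> A\<^sup>T z - E x\<^sup>+\<close>. With \<open>D\<close> the sign matrix of \<open>x\<^sub>k\<close>, subtracting the two equations gives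
  \<open>(I + E D) (x\<^bsub>k+1\<^esub> - u) = - E (D u - u\<^sup>+)\<close>, and each component of \<open>D u - u\<^sup>+\<close> is bounded by that of
  \<open>x\<^sub>k - u\<close>, so the error contracts by \<open>b / (1 - b) < 1\<close>. The projection formula holds because
  \<open>A\<^sup>T (z - A u\<^sup>+) = u - u\<^sup>+\<close> is nonpositive and orthogonal to \<open>u\<^sup>+\<close>.\<close>

lemma norm_mult_vec_le_op_norm:
  fixes M :: "real ^ 'm ^ 'm"
  shows "norm (M *v x) \<le> op_norm M * norm x"
  unfolding op_norm_def by (rule onorm) (rule matrix_vector_mul_bounded_linear)

text \<open>The map \<open>t \<mapsto> max t 0\<close> is 1-Lipschitz in each component. This makes
  the fixed-point map for \<open>u\<close> Lipschitz with constant \<open>op_norm E\<close>.\<close>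

lemma norm_pos_part_diff_le: "norm (pos_part x - pos_part y) \<le> norm (x - y)"
  by (rule norm_le_componentwise_cart) (auto simp: pos_part_def)

lemma diag_mat_mult_vec_component: "(diag_mat d *v x) $ i = d $ i * x $ i"
proof -
  have "(diag_mat d *v x) $ i = (\<Sum>j\<in>UNIV. if i = j then d $ i * x $ j else 0)"
    unfolding diag_mat_def matrix_vector_mult_def vec_lambda_beta by (intro sum.cong) auto
  then show ?thesis
    by simp
qed

lemma norm_diag_sign_mult_vec_le: "norm (diag_mat (sign_vec (pos_part x)) *v y) \<le> norm y"
  by (rule norm_le_componentwise_cart)
     (auto simp: diag_mat_mult_vec_component sign_vec_def pos_part_def sgn_if)

text \<open>A component of the left-hand vector vanishes unless \<open>x $ i > 0 > u $ i\<close> or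
  \<open>x $ i \<le> 0 < u $ i\<close>. In both cases its modulus is
  \<open>\<bar>u $ i\<bar>\<close>, and since the signs disagree this is at most
  \<open>\<bar>x $ i - u $ i\<bar>\<close>.\<close>

lemma norm_diag_sign_mult_vec_diff_pos_part_le:
  "norm (diag_mat (sign_vec (pos_part x)) *v u - pos_part u) \<le> norm (x - u)"
  by (rule norm_le_componentwise_cart)
     (auto simp: diag_mat_mult_vec_component sign_vec_def pos_part_def sgn_if)

lemma pw_linear_ex1:
  fixes E :: "real ^ 'm ^ 'm"
  assumes "op_norm E < 1"
  shows "\<exists>!u. E *v pos_part u + u = q"
proof -
  have "\<exists>!u. q - E *v pos_part u = u"
  proof (rule banach_fix_type)
    show "0 \<le> op_norm E"
      unfolding op_norm_def by (rule onorm_pos_le) (rule matrix_vector_mul_bounded_linear)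
    show "\<forall>x y. dist (q - E *v pos_part x) (q - E *v pos_part y) \<le> op_norm E * dist x y"
    proof (intro allI)
      fix x y
      have "dist (q - E *v pos_part x) (q - E *v pos_part y)
          = norm (E *v (pos_part y - pos_part x))"
        by (simp add: dist_norm matrix_vector_mult_diff_distrib)
      also have "\<dots> \<le> op_norm E * norm (pos_part y - pos_part x)"
        by (rule norm_mult_vec_le_op_norm)
      also have "\<dots> \<le> op_norm E * dist x y"
        using \<open>0 \<le> op_norm E\<close> norm_pos_part_diff_le[of y x]
        by (simp add: dist_norm norm_minus_commute mult_left_mono)
      finally show "dist (q - E *v pos_part x) (q - E *v pos_part y) \<le> op_norm E * dist x y" .
    qed
  qed (rule assms)
  moreover have "E *v pos_part u + u = q \<longleftrightarrow> q - E *v pos_part u = u" for u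
    by (auto simp: algebra_simps)
  ultimately show ?thesis
    by simp
qed

text \<open>A quantitative form of injectivity: it gives both the solvability of each Newton step
  and the denominator of the contraction rate.\<close>

lemma norm_newton_matrix_mult_vec_ge:
  fixes E :: "real ^ 'm ^ 'm"
  shows "(1 - op_norm E) * norm v
    \<le> norm ((E ** diag_mat (sign_vec (pos_part x)) + mat 1) *v v)"
proof -
  let ?D = "diag_mat (sign_vec (pos_part x))"
  have "0 \<le> op_norm E"
    unfolding op_norm_def by (rule onorm_pos_le) (rule matrix_vector_mul_bounded_linear)
  have "norm (E *v (?D *v v)) \<le> op_norm E * norm (?D *v v)"
    by (rule norm_mult_vec_le_op_norm)
  also have "\<dots> \<le> op_norm E * norm v"
    by (intro mult_left_mono norm_diag_sign_mult_vec_le \<open>0 \<le> op_norm E\<close>)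
  finally have "norm (E *v (?D *v v)) \<le> op_norm E * norm v" .
  \<comment> \<open>Here \<open>v\<close> is written as
    \<open>(E *v (?D *v v) + v) - E *v (?D *v v)\<close>.\<close>
  moreover have "norm v \<le> norm (E *v (?D *v v) + v) + norm (E *v (?D *v v))"
    using norm_triangle_ineq4[of "E *v (?D *v v) + v" "E *v (?D *v v)"] by simp
  ultimately show ?thesis
    by (simp add: matrix_vector_mult_add_rdistrib matrix_vector_mul_assoc[symmetric] algebra_simps)
qed

lemma newton_step_ex1:
  fixes E :: "real ^ 'm ^ 'm"
  assumes "op_norm E < 1"
  shows "\<exists>!y. (E ** diag_mat (sign_vec (pos_part x)) + mat 1) *v y = q"
proof -
  let ?N = "E ** diag_mat (sign_vec (pos_part x)) + mat 1"
  have "inj ((*v) ?N)"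
  proof (rule injI)
    fix v w assume "?N *v v = ?N *v w"
    then have "(1 - op_norm E) * norm (v - w) \<le> 0"
      using norm_newton_matrix_mult_vec_ge[of E "v - w" x]
      by (simp add: matrix_vector_mult_diff_distrib)
    then show "v = w"
      using assms by (simp add: mult_le_0_iff)
  qed
  moreover from this have "surj ((*v) ?N)"
    by (intro linear_inj_imp_surj matrix_vector_mul_linear)
  ultimately show ?thesis
    by (metis injD surjD)
qed

lemma newton_step_error:
  fixes E :: "real ^ 'm ^ 'm"
  assumes "E *v pos_part u + u = q"
    and "(E ** diag_mat (sign_vec (pos_part x)) + mat 1) *v y = q"
  shows "(1 - op_norm E) * norm (y - u) \<le> op_norm E * norm (x - u)"
proof -
  let ?D = "diag_mat (sign_vec (pos_part x))"
  have "0 \<le> op_norm E"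
    unfolding op_norm_def by (rule onorm_pos_le) (rule matrix_vector_mul_bounded_linear)
  have "(E ** ?D + mat 1) *v (y - u) = E *v pos_part u + u - (E ** ?D + mat 1) *v u"
    using assms by (simp add: matrix_vector_mult_diff_distrib)
  also have "\<dots> = - (E *v (?D *v u - pos_part u))"
    by (simp add: matrix_vector_mult_add_rdistrib matrix_vector_mul_assoc[symmetric]
        matrix_vector_mult_diff_distrib)
  finally have "(1 - op_norm E) * norm (y - u) \<le> norm (E *v (?D *v u - pos_part u))"
    using norm_newton_matrix_mult_vec_ge[of E "y - u" x] by simp
  also have "\<dots> \<le> op_norm E * norm (?D *v u - pos_part u)"
    by (rule norm_mult_vec_le_op_norm)
  also have "\<dots> \<le> op_norm E * norm (x - u)"
    by (intro mult_left_mono norm_diag_sign_mult_vec_diff_pos_part_le \<open>0 \<le> op_norm E\<close>)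
  finally show ?thesis .
qed

text \<open>The Newton iterates are given only implicitly, by a linear system at each step. Unique
  solvability of every step is turned into a unique sequence by recursion with
  \<open>THE\<close>.\<close>

lemma ex1_recursive_sequence:
  assumes "\<And>a. \<exists>!b. R a b"
  shows "\<exists>!x. x 0 = x0 \<and> (\<forall>k::nat. R (x k) (x (Suc k)))"
proof (rule ex1I)
  let ?x = "rec_nat x0 (\<lambda>_ a. THE b. R a b)"
  show "?x 0 = x0 \<and> (\<forall>k. R (?x k) (?x (Suc k)))"
    using theI'[OF assms] by simp
  fix y assume y: "y 0 = x0 \<and> (\<forall>k. R (y k) (y (Suc k)))"
  have "y k = ?x k" for k
  proof (induction k)
    case (Suc k)
    have "(THE b. R (y k) b) = y (Suc k)"
      using y by (intro the1_equality assms) simp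
    with Suc show ?case
      by simp
  qed (use y in simp)
  then show "y = ?x" ..
qed

lemma converges_linearlyI:
  assumes "0 \<le> c" "c < 1" and step: "\<And>k. norm (x (Suc k) - u) \<le> c * norm (x k - u)"
  shows "converges_linearly x u"
proof -
  have bound: "norm (x k - u) \<le> norm (x 0 - u) * c ^ k" for k
  proof (induction k)
    case (Suc k)
    then show ?case
      using step[of k] mult_left_mono[OF Suc \<open>0 \<le> c\<close>] by (simp add: mult.left_commute)
  qed simp
  have "(\<lambda>k. norm (x 0 - u) * c ^ k) \<longlonglongrightarrow> 0"
    using assms by (intro tendsto_mult_right_zero LIMSEQ_power_zero) simp
  then have "(\<lambda>k. x k - u) \<longlonglongrightarrow> 0"
    by (rule Lim_null_comparison[rotated]) (simp add: bound)
  then show ?thesis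
    using assms unfolding converges_linearly_def by (auto simp: LIM_zero_iff)
qed

lemma convex_nonneg_orthant: "convex nonneg_orthant"
  by (auto simp: nonneg_orthant_def convex_def)

lemma closed_nonneg_orthant: "closed nonneg_orthant"
  unfolding nonneg_orthant_def by (intro closed_Collect_all closed_Collect_le continuous_intros)

lemma closest_point_simplicial_cone:
  fixes A :: "real ^ 'm ^ 'm"
  assumes "invertible A" and "solves_pw_linear A z u"
  shows "closest_point (simplicial_cone A) z = A *v pos_part u"
proof (rule closest_point_unique[symmetric])
  let ?p = "A *v pos_part u"
  show "convex (simplicial_cone A)"
    unfolding simplicial_cone_def
    by (intro convex_linear_image convex_nonneg_orthant matrix_vector_mul_linear)
  \<comment> \<open>Injectivity is what makes the cone closed, as the image of a closed set under an
    injective linear map.\<close>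
  have "inj ((*v) A)"
    using assms(1) by (simp add: inj_matrix_vector_mult)
  then show "closed (simplicial_cone A)"
    unfolding simplicial_cone_def
    by (intro closed_injective_linear_image closed_nonneg_orthant matrix_vector_mul_linear)
  show "?p \<in> simplicial_cone A"
    by (auto simp: simplicial_cone_def nonneg_orthant_def pos_part_def)
  have residual: "transpose A *v (z - ?p) = u - pos_part u"
    using assms(2) unfolding solves_pw_linear_def
    by (simp add: matrix_vector_mult_diff_distrib matrix_vector_mult_diff_rdistrib
        matrix_vector_mul_assoc algebra_simps)
  show "\<forall>y\<in>simplicial_cone A. dist z ?p \<le> dist z y"
  proof
    fix y assume "y \<in> simplicial_cone A"
    then obtain w where w: "y = A *v w" "w \<in> nonneg_orthant"
      by (auto simp: simplicial_cone_def)
    have "(z - ?p) \<bullet> (y - ?p) = (transpose A *v (z - ?p)) \<bullet> (w - pos_part u)"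
      by (simp add: w(1) dot_lmul_matrix[symmetric] matrix_vector_mult_diff_distrib[symmetric])
    also have "\<dots> = (\<Sum>i\<in>UNIV. (u - pos_part u) $ i * (w - pos_part u) $ i)"
      by (simp only: residual) (simp add: inner_vec_def)
    \<comment> \<open>Where \<open>u $ i > 0\<close> the first factor is zero. Elsewhere the term is
      \<open>u $ i * w $ i\<close> with \<open>u $ i \<le> 0 \<le> w $ i\<close>.\<close>
    also have "\<dots> \<le> 0"
      using w(2) by (intro sum_nonpos)
        (auto simp: nonneg_orthant_def pos_part_def max_def mult_nonpos_nonneg)
    finally have "(z - ?p) \<bullet> (y - ?p) \<le> 0" .
    \<comment> \<open>Expanding \<open>z - y = (z - ?p) - (y - ?p)\<close>: a nonpositive inner
      product means that moving from \<open>?p\<close> to \<open>y\<close> cannot bring the point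
      closer to \<open>z\<close>.\<close>
    moreover have "(norm (z - y))\<^sup>2
        = (norm (z - ?p))\<^sup>2 - 2 * ((z - ?p) \<bullet> (y - ?p)) + (norm (y - ?p))\<^sup>2"
      by (simp add: power2_norm_eq_inner algebra_simps inner_commute)
    ultimately have "(norm (z - ?p))\<^sup>2 \<le> (norm (z - y))\<^sup>2"
      using zero_le_power2[of "norm (y - ?p)"] by linarith
    then show "dist z ?p \<le> dist z y"
      by (simp add: dist_norm)
  qed
qed

theorem theorem2:
  fixes A :: "real ^ 'm ^ 'm" and z :: "real ^ 'm" and b :: real
  assumes "invertible A"
    and "0 < b" and "b < 1 / 3"
    and "op_norm (transpose A ** A - mat 1) < b"
  shows "\<exists>u. solves_pw_linear A z u \<and> (\<forall>v. solves_pw_linear A z v \<longrightarrow> v = u) \<and>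
    (\<forall>x0. (\<exists>!x. semismooth_newton_seq A z x0 x) \<and>
          (\<forall>x. semismooth_newton_seq A z x0 x \<longrightarrow> converges_linearly x u)) \<and>
    closest_point (simplicial_cone A) z = A *v pos_part u"
proof -
  let ?E = "transpose A ** A - mat 1"
  have E: "op_norm ?E < 1"
    using assms by simp
  obtain u where u: "solves_pw_linear A z u" "\<And>v. solves_pw_linear A z v \<Longrightarrow> v = u"
    using pw_linear_ex1[OF E] unfolding solves_pw_linear_def by metis
  have "converges_linearly x u" if "semismooth_newton_seq A z x0 x" for x0 x
  proof (rule converges_linearlyI)
    \<comment> \<open>The bound \<open>b < 1 / 3\<close> keeps this rate below
      \<open>1 / 2\<close>.\<close>
    show "0 \<le> b / (1 - b)" "b / (1 - b) < 1"
      using assms by auto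
    fix k
    have "(1 - op_norm ?E) * norm (x (Suc k) - u) \<le> op_norm ?E * norm (x k - u)"
      using u(1) that unfolding solves_pw_linear_def semismooth_newton_seq_def
      by (blast intro: newton_step_error)
    \<comment> \<open>Replacing \<open>op_norm ?E\<close> by the larger \<open>b\<close> shrinks the
      left side of the error estimate and enlarges the right side.\<close>
    moreover have "(1 - b) * norm (x (Suc k) - u) \<le> (1 - op_norm ?E) * norm (x (Suc k) - u)"
      using assms by (intro mult_right_mono) auto
    moreover have "op_norm ?E * norm (x k - u) \<le> b * norm (x k - u)"
      using assms by (intro mult_right_mono) auto
    ultimately have "(1 - b) * norm (x (Suc k) - u) \<le> b * norm (x k - u)"
      by linarith
    then show "norm (x (Suc k) - u) \<le> b / (1 - b) * norm (x k - u)"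
      using assms by (simp add: field_simps)
  qed
  moreover have "\<exists>!x. semismooth_newton_seq A z x0 x" for x0
    unfolding semismooth_newton_seq_def by (intro ex1_recursive_sequence newton_step_ex1 E)
  ultimately show ?thesis
    using u closest_point_simplicial_cone[OF assms(1) u(1)] by blast
qed

end
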